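(* Let $(X_N)_{N\ge1}$ be a sequence of bounded random variables with values in $\mathbb{N}_0=\{0,1,2,\ldots\}$, with variances $\sigma_N^2>0$ and probability generating functions $f_N(z)=\mathbb{E}[z^{X_N}]$ (which are polynomials). For $N\ge1$ let $\delta_N\in(0,\pi]$ be such that $f_N$ has no roots in the sector $S(\delta_N)$. Put $\Delta_N:=c\,\delta_N\sigma_N$ with the absolute constant $c>0$ of the context, and $X_N^\ast:=(X_N-\mathbb{E}X_N)/\sigma_N$. Then there exists an absolute constant $C>0$ such that for all $N\ge1$ and all $x\ge0$, $$\mathbb{P}(X_N^\ast\ge x)\le C\exp\Big(-\frac12\,\frac{x^2}{2+x/\Delta_N}\Big).$$
   Context: For $\delta\in(0,\pi]$, $S(\delta):=\{z\in\mathbb{C}\setminus\{0\}:\arg(z)\in(-\delta,\delta)\}$, where $\arg(z)\in(-\pi,\pi]$. The cumulant of order $m$ of a random variable $X$ is denoted $\kappa_m(X)$. The constant $c>0$ is a fixed absolute constant with the following property (such a constant exists, and $c=2^{-3248}$ is admissible): for every bounded $\mathbb{N}_0$-valued random variable $X$ with variance $\sigma^2>0$ whose probability generating function has no roots in $S(\delta)$, where $\delta\in(0,\pi]$, one has $|\kappa_m((X-\mathbb{E}X)/\sigma)|\le m!/(c\,\delta\,\sigma)^{m-2}$ for all integers $m\ge3$. *)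

theory Defs
  imports "HOL-Probability.Probability"
begin

(* Arg takes values in (-pi, pi]; since Arg 0 = 0, the origin has to be excluded explicitly. *)
definition sector :: "real \<Rightarrow> complex set" where
  "sector \<delta> = {z. z \<noteq> 0 \<and> - \<delta> < Arg z \<and> Arg z < \<delta>}"

definition pgf :: "'a measure \<Rightarrow> ('a \<Rightarrow> nat) \<Rightarrow> complex \<Rightarrow> complex" where
  "pgf M X z = (\<integral>\<omega>. z ^ X \<omega> \<partial>M)"

(* m-th derivative at 0 of the cumulant generating function log E[exp (t Y)]. For bounded Y, the
   only case used below, this is a smooth function of the real variable t. *)
definition cumulant :: "nat \<Rightarrow> 'a measure \<Rightarrow> ('a \<Rightarrow> real) \<Rightarrow> real" where
  "cumulant m M Y = (deriv ^^ m) (\<lambda>t. ln (\<integral>\<omega>. exp (t * Y \<omega>) \<partial>M)) 0"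

definition std_dev :: "'a measure \<Rightarrow> ('a \<Rightarrow> nat) \<Rightarrow> real" where
  "std_dev M X = sqrt (prob_space.variance M (\<lambda>\<omega>. real (X \<omega>)))"

definition standardized :: "'a measure \<Rightarrow> ('a \<Rightarrow> nat) \<Rightarrow> 'a \<Rightarrow> real" where
  "standardized M X \<omega> =
     (real (X \<omega>) - prob_space.expectation M (\<lambda>\<omega>. real (X \<omega>))) / std_dev M X"

definition sector_free_rv :: "'a measure \<Rightarrow> ('a \<Rightarrow> nat) \<Rightarrow> real \<Rightarrow> bool" where
  "sector_free_rv M X \<delta> \<longleftrightarrow>
     prob_space M \<and> X \<in> measurable M (count_space UNIV) \<and>
     (\<exists>B. AE \<omega> in M. X \<omega> \<le> B) \<and>
     prob_space.variance M (\<lambda>\<omega>. real (X \<omega>)) > 0 \<and>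
     0 < \<delta> \<and> \<delta> \<le> pi \<and> (\<forall>z \<in> sector \<delta>. pgf M X z \<noteq> 0)"

(* The property of the fixed absolute constant c. Every law on the natural numbers is realised by
   a random variable whose sample space is of type nat, and everything here depends only on the
   law, so quantifying over sample spaces of this type covers all random variables. *)
definition cumulant_bound_const :: "real \<Rightarrow> bool" where
  "cumulant_bound_const c \<longleftrightarrow> c > 0 \<and>
     (\<forall>(M :: nat measure) X \<delta>. sector_free_rv M X \<delta> \<longrightarrow>
       (\<forall>m\<ge>3. \<bar>cumulant m M (standardized M X)\<bar> \<le> fact m / (c * \<delta> * std_dev M X) ^ (m - 2)))"

(* C works for all sequences of random variables on sample spaces of the given type; X N may live
   on its own probability space M N, as only the marginal laws matter. Index 0 is unused. *)
definition tail_bound_const :: "real \<Rightarrow> 'a itself \<Rightarrow> real \<Rightarrow> bool" where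
  "tail_bound_const c (_ :: 'a itself) C \<longleftrightarrow>
     (\<forall>(M :: nat \<Rightarrow> 'a measure) (X :: nat \<Rightarrow> 'a \<Rightarrow> nat) (\<delta> :: nat \<Rightarrow> real).
       (\<forall>N\<ge>1. sector_free_rv (M N) (X N) (\<delta> N)) \<longrightarrow>
       (\<forall>N\<ge>1. let \<Delta> = c * \<delta> N * std_dev (M N) (X N) in
         \<forall>x\<ge>0. measure (M N) {\<omega> \<in> space (M N). standardized (M N) (X N) \<omega> \<ge> x}
           \<le> C * exp (- (1/2) * (x\<^sup>2 / (2 + x / \<Delta>)))))"

end

(* The cumulants are the Taylor coefficients at 0 of the logarithm of the moment generating
   function. Their bounds make the Taylor series T converge on the disc of radius Delta. Although the
   logarithm itself is only known to be holomorphic near 0, the identity exp T = E[exp (z X)] extends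
   to the whole disc, since the right-hand side is entire. With variance 1, a geometric series gives
   E[exp (t X)] \<le> exp (t^2 / (1 - t / Delta)) for 0 \<le> t < Delta, and the exponential Markov
   inequality at t = x / (2 + x / Delta) yields the tail bound with constant C = 1. *)
theory Submission
  imports Defs "HOL-Complex_Analysis.Complex_Analysis"
begin

section \<open>Derivatives of holomorphic functions along the real axis\<close>

text \<open>Along the real line the complex derivative is a vector derivative: its real part
  differentiates \<open>h\<close>, its imaginary part differentiates the constant 0. This links
  cumulants, which are real derivatives, to complex Taylor coefficients.\<close>

lemma deriv_restrict_real:
  fixes g :: "complex \<Rightarrow> complex" and h :: "real \<Rightarrow> real"
  assumes A: "open A" and g: "g holomorphic_on A"
    and eq: "\<And>s. of_real s \<in> A \<Longrightarrow> g (of_real s) = of_real (h s)"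
    and t: "of_real t \<in> A"
  shows "deriv g (of_real t) = of_real (deriv h t)"
proof -
  let ?d = "deriv g (of_real t)" and ?S = "complex_of_real -` A"
  have S: "open ?S" by (intro open_vimage A continuous_intros)
  have "(g has_field_derivative ?d) (at (of_real t))"
    using holomorphic_derivI[OF g A t] .
  then have "((\<lambda>s. g (of_real s)) has_vector_derivative ?d) (at t)"
    by (rule has_vector_derivative_real_field)
  then have *: "((\<lambda>s. complex_of_real (h s)) has_vector_derivative ?d) (at t)"
    by (rule has_vector_derivative_transform_within_open[OF _ S]) (use t eq in auto)
  have "(h has_vector_derivative Re ?d) (at t)"
    using bounded_linear.has_vector_derivative[OF bounded_linear_Re *] by simp
  then have "deriv h t = Re ?d"
    by (simp add: has_real_derivative_iff_has_vector_derivative[symmetric] DERIV_imp_deriv)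
  moreover have "((\<lambda>_. 0) has_vector_derivative Im ?d) (at t)"
    using bounded_linear.has_vector_derivative[OF bounded_linear_Im *] by simp
  then have "Im ?d = 0"
    using vector_derivative_unique_at[OF _ has_vector_derivative_const] by blast
  ultimately show ?thesis by (simp add: complex_eq_iff)
qed

text \<open>The previous lemma reproduces its hypothesis \<open>eq\<close> for the derivatives at
  every real point of \<open>A\<close>, so it can be iterated; hence the induction over arbitrary
  \<open>t\<close>.\<close>

lemma higher_deriv_restrict_real:
  fixes g :: "complex \<Rightarrow> complex" and h :: "real \<Rightarrow> real"
  assumes A: "open A" and g: "g holomorphic_on A"
    and eq: "\<And>s. of_real s \<in> A \<Longrightarrow> g (of_real s) = of_real (h s)"
  shows "of_real t \<in> A \<Longrightarrow> (deriv ^^ n) g (of_real t) = of_real ((deriv ^^ n) h t)"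
proof (induction n arbitrary: t)
  case (Suc n)
  then show ?case
    using deriv_restrict_real[OF A holomorphic_higher_deriv[OF g A], of n "(deriv ^^ n) h" t] by simp
qed (use eq in simp)

section \<open>From cumulant bounds to a bound on the moment generating function\<close>

text \<open>Here \<open>p\<close> and \<open>y\<close> are the weights and values of a finitely
  supported law with mean 0 and variance 1. Finite support makes the generating function a finite
  sum of exponentials, hence entire.\<close>

lemma mgf_le_of_cumulant_bounds:
  fixes p y :: "nat \<Rightarrow> real" and \<phi> :: "real \<Rightarrow> real"
  assumes \<phi>_def: "\<phi> = (\<lambda>t. \<Sum>k\<in>I. p k * exp (t * y k))"
    and I: "finite I" and p: "\<And>k. k \<in> I \<Longrightarrow> p k \<ge> 0"
    and p1: "(\<Sum>k\<in>I. p k) = 1" and py: "(\<Sum>k\<in>I. p k * y k) = 0"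
    and py2: "(\<Sum>k\<in>I. p k * (y k)\<^sup>2) = 1"
    and \<Delta>: "\<Delta> > 0"
    and bound: "\<And>m. m \<ge> 3 \<Longrightarrow> \<bar>(deriv ^^ m) (\<lambda>t. ln (\<phi> t)) 0\<bar> \<le> fact m / \<Delta> ^ (m - 2)"
    and t: "0 \<le> t" "t < \<Delta>"
  shows "\<phi> t \<le> exp (t\<^sup>2 / (1 - t / \<Delta>))"
proof -
  define \<phi>c :: "complex \<Rightarrow> complex" where
    "\<phi>c = (\<lambda>z. \<Sum>k\<in>I. of_real (p k) * exp (z * of_real (y k)))"
  define K where "K = (\<lambda>t. ln (\<phi> t))"
  define a :: "nat \<Rightarrow> complex" where "a n = of_real ((deriv ^^ n) K 0 / fact n)" for n
  have \<phi>c_real: "\<phi>c (of_real s) = of_real (\<phi> s)" for s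
    by (simp add: \<phi>c_def \<phi>_def exp_of_real flip: of_real_mult)
  have \<phi>c_hol: "\<phi>c holomorphic_on A" for A
    unfolding \<phi>c_def by (intro holomorphic_intros)
  have \<phi>0: "\<phi> 0 = 1" by (simp add: \<phi>_def p1)
  have \<phi>_pos: "\<phi> s > 0" for s
  proof -
    have "\<exists>k\<in>I. p k \<noteq> 0" using p1 by (metis sum.neutral zero_neq_one)
    then obtain k where k: "k \<in> I" "p k \<noteq> 0" by blast
    have "0 < p k * exp (s * y k)" using k p[of k] by simp
    also have "\<dots> \<le> \<phi> s" unfolding \<phi>_def
      by (rule member_le_sum) (use k I p in auto)
    finally show ?thesis .
  qed

  have d\<phi>: "(\<phi> has_real_derivative (\<Sum>k\<in>I. p k * y k * exp (s * y k))) (at s)" for s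
    unfolding \<phi>_def by (auto intro!: derivative_eq_intros sum.cong)
  have d2\<phi>: "((\<lambda>s. \<Sum>k\<in>I. p k * y k * exp (s * y k)) has_real_derivative
       (\<Sum>k\<in>I. p k * (y k)\<^sup>2 * exp (s * y k))) (at s)" for s
    by (auto intro!: derivative_eq_intros sum.cong simp: power2_eq_square)
  have dK: "(K has_real_derivative (\<Sum>k\<in>I. p k * y k * exp (s * y k)) / \<phi> s) (at s)" for s
    unfolding K_def using \<phi>_pos[of s] by (auto intro!: derivative_eq_intros d\<phi>)
  then have derivK: "deriv K = (\<lambda>s. (\<Sum>k\<in>I. p k * y k * exp (s * y k)) / \<phi> s)"
    by (auto intro: DERIV_imp_deriv)
  \<comment> \<open>At 0 the quotient rule gives (1 * 1 - 0 * 0) / 1, from variance 1, mean 0 and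
    \<open>\<phi> 0 = 1\<close>.\<close>
  have "(deriv K has_real_derivative 1) (at 0)"
    unfolding derivK using DERIV_divide[OF d2\<phi>[of 0] d\<phi>[of 0]] \<phi>0 py py2 by simp
  then have K2: "deriv (deriv K) 0 = 1" by (rule DERIV_imp_deriv)
  have a01: "a 0 = 0" "a (Suc 0) = 0"
    using \<phi>0 py by (simp_all add: a_def derivK) (simp add: K_def)
  \<comment> \<open>The assumed bounds start at order 3. For \<open>n = 0\<close> the coefficient is
    1/2 because the variance is 1, and estimating it by 1 lets one geometric series dominate all
    terms.\<close>
  have a_bound: "norm (a (n + 2)) \<le> 1 / \<Delta> ^ n" for n
  proof (cases "n = 0")
    case True
    then show ?thesis by (simp add: a_def K2 numeral_2_eq_2)
  next
    case False
    then have "\<bar>(deriv ^^ (n + 2)) K 0\<bar> / fact (n + 2) \<le> (fact (n + 2) / \<Delta> ^ n) / fact (n + 2)"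
      using bound[of "n + 2"] unfolding K_def by (intro divide_right_mono) simp_all
    then show ?thesis
      by (simp only: a_def norm_of_real abs_divide abs_of_pos fact_gt_zero) simp
  qed
  have sums_bound: "(\<lambda>n. norm z ^ (n + 2) / \<Delta> ^ n) sums ((norm z)\<^sup>2 / (1 - norm z / \<Delta>))"
    if "norm z < \<Delta>" for z :: complex
  proof -
    have "(\<lambda>n. (norm z)\<^sup>2 * (norm z / \<Delta>) ^ n) sums ((norm z)\<^sup>2 * (1 / (1 - norm z / \<Delta>)))"
      by (intro sums_mult geometric_sums) (use that \<Delta> in simp)
    then show ?thesis by (simp add: power_divide power2_eq_square mult_ac)
  qed
  have term_bound: "norm (a (n + 2) * z ^ (n + 2)) \<le> norm z ^ (n + 2) / \<Delta> ^ n" for n z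
    using mult_right_mono[OF a_bound[of n], of "norm z ^ (n + 2)"]
    by (simp only: norm_mult norm_power zero_le_power norm_ge_zero) simp
  \<comment> \<open>The series starts at order 2, where \<open>a_bound\<close> applies; by
    \<open>a01\<close> it is still the full Taylor series.\<close>
  define T where "T z = (\<Sum>n. a (n + 2) * z ^ (n + 2))" for z
  have T_sums': "(\<lambda>n. a (n + 2) * z ^ (n + 2)) sums T z" if "norm z < \<Delta>" for z
    unfolding T_def
    by (rule summable_sums, rule summable_comparison_test'[OF sums_summable[OF sums_bound[OF that]]])
      (rule term_bound)
  have T_sums: "(\<lambda>n. a n * z ^ n) sums T z" if "norm z < \<Delta>" for z
    using T_sums'[OF that] a01 by (subst (asm) sums_iff_shift) (simp add: numeral_2_eq_2)
  have T_norm: "norm (T z) \<le> (norm z)\<^sup>2 / (1 - norm z / \<Delta>)" if "norm z < \<Delta>" for z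
    using norm_sums_le[OF T_sums'[OF that] sums_bound[OF that] term_bound] .
  have T_hol: "T holomorphic_on ball 0 \<Delta>"
    by (rule power_series_holomorphic[where a = a]) (use T_sums in simp)

  \<comment> \<open>Within distance 1 of 1 the values of \<open>\<phi>c\<close> avoid the branch
    cut, so the principal logarithm is holomorphic on \<open>ball 0 r\<close>.\<close>
  have "continuous (at 0) \<phi>c" unfolding \<phi>c_def by (intro continuous_intros)
  moreover have "\<phi>c 0 = 1" using \<phi>c_real[of 0] \<phi>0 by simp
  ultimately obtain r where r: "r > 0" "\<And>z. norm z < r \<Longrightarrow> dist (\<phi>c z) 1 < 1"
    unfolding continuous_at_eps_delta by (auto simp: dist_norm) (metis zero_less_one)
  have ball1: "\<phi>c z \<notin> \<real>\<^sub>\<le>\<^sub>0" if "norm z < r" for z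
  proof
    assume "\<phi>c z \<in> \<real>\<^sub>\<le>\<^sub>0"
    then have "Re (\<phi>c z) \<le> 0" by (simp add: complex_nonpos_Reals_iff)
    moreover have "\<bar>Re (\<phi>c z - 1)\<bar> < 1"
      using r(2)[OF that] abs_Re_le_cmod[of "\<phi>c z - 1"] by (simp add: dist_norm)
    ultimately show False by simp
  qed
  define L where "L = (\<lambda>z. Ln (\<phi>c z))"
  have L_hol: "L holomorphic_on ball 0 r"
    unfolding L_def using ball1 by (intro holomorphic_intros \<phi>c_hol) auto
  have L_real: "L (of_real s) = of_real (K s)" for s
    using \<phi>_pos[of s] by (simp add: L_def K_def \<phi>c_real Ln_of_real)
  have L_sums: "(\<lambda>n. a n * z ^ n) sums L z" if "norm z < r" for z
  proof -
    \<comment> \<open>The coefficients \<open>a\<close> come from the real function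
      \<open>K\<close>; since \<open>L\<close> agrees with \<open>K\<close> on the real axis, they
      are also the Taylor coefficients of \<open>L\<close>.\<close>
    have "(deriv ^^ n) L 0 / fact n = a n" for n
      using higher_deriv_restrict_real[OF open_ball L_hol L_real, of 0 n] r(1)
      by (simp add: a_def)
    then show ?thesis
      using holomorphic_power_series[OF L_hol, of z] that by simp
  qed
  have near: "exp (T z) = \<phi>c z" if "z \<in> ball 0 (min r \<Delta>)" for z
  proof -
    have "T z = L z" using that T_sums L_sums by (auto intro: sums_unique2)
    moreover have "\<phi>c z \<noteq> 0" using ball1[of z] that by auto
    ultimately show ?thesis by (simp add: L_def)
  qed
  \<comment> \<open>Identity theorem on \<open>ball 0 \<Delta>\<close>: both sides are holomorphic
    there and agree on the smaller ball by \<open>near\<close>.\<close>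
  have "exp (T (of_real t)) = \<phi>c (of_real t)"
    by (rule analytic_continuation_open[where s = "ball 0 (min r \<Delta>)" and s' = "ball 0 \<Delta>"])
      (use t r(1) \<Delta> near in \<open>auto intro!: holomorphic_intros \<phi>c_hol T_hol\<close>)
  then have "of_real (\<phi> t) = exp (T (of_real t))" by (simp add: \<phi>c_real)
  then have "\<phi> t = norm (exp (T (of_real t)))"
    using \<phi>_pos[of t] by (metis abs_of_pos norm_of_real)
  also have "\<dots> \<le> exp (norm (T (of_real t)))"
    using complex_Re_le_cmod by simp
  also have "\<dots> \<le> exp (t\<^sup>2 / (1 - t / \<Delta>))"
    using T_norm[of "of_real t"] t by simp
  finally show ?thesis .
qed

section \<open>Exponential tail bound for bounded variables\<close>

text \<open>Outside a null set, \<open>g (X \<omega>)\<close> is a finite combination of indicators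
  of the level sets of \<open>X\<close>. This turns expectations into the finite sums required
  above.\<close>

lemma integral_bounded_nat:
  fixes g :: "nat \<Rightarrow> 'b :: {banach, second_countable_topology}"
  assumes "prob_space M" and X: "X \<in> measurable M (count_space UNIV)"
    and B: "AE \<omega> in M. X \<omega> \<le> B"
  shows "integrable M (\<lambda>\<omega>. g (X \<omega>))"
    and "(\<integral>\<omega>. g (X \<omega>) \<partial>M) = (\<Sum>k\<le>B. measure M (X -` {k} \<inter> space M) *\<^sub>R g k)"
proof -
  interpret prob_space M by fact
  let ?A = "\<lambda>k. X -` {k} \<inter> space M"
  have A: "?A k \<in> sets M" for k using X by (rule measurable_sets) simp
  have "has_bochner_integral M (\<lambda>\<omega>. \<Sum>k\<le>B. indicator (?A k) \<omega> *\<^sub>R g k)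
      (\<Sum>k\<le>B. measure M (?A k) *\<^sub>R g k)"
    by (intro has_bochner_integral_sum has_bochner_integral_scaleR_left
        has_bochner_integral_real_indicator A) (simp add: emeasure_eq_measure)
  moreover have "AE \<omega> in M. (\<Sum>k\<le>B. indicator (?A k) \<omega> *\<^sub>R g k) = g (X \<omega>)"
    using B AE_space
  proof eventually_elim
    case (elim \<omega>)
    have "(\<Sum>k\<le>B. indicator (?A k) \<omega> *\<^sub>R g k) = (\<Sum>k\<le>B. if k = X \<omega> then g k else 0)"
      using elim by (intro sum.cong) (auto simp: indicator_def)
    then show ?case using elim by simp
  qed
  moreover have "(\<lambda>\<omega>. g (X \<omega>)) \<in> borel_measurable M"
    using X by (rule measurable_compose) simp
  ultimately have "has_bochner_integral M (\<lambda>\<omega>. g (X \<omega>)) (\<Sum>k\<le>B. measure M (?A k) *\<^sub>R g k)"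
    by (subst has_bochner_integral_cong_AE[symmetric]) (auto intro: borel_measurable_has_bochner_integral)
  then show "integrable M (\<lambda>\<omega>. g (X \<omega>))"
    and "(\<integral>\<omega>. g (X \<omega>) \<partial>M) = (\<Sum>k\<le>B. measure M (?A k) *\<^sub>R g k)"
    by (auto simp: has_bochner_integral_iff)
qed

lemma standardized_tail_bound:
  assumes sf: "sector_free_rv M X \<delta>" and \<Delta>: "\<Delta> > 0"
    and bound: "\<And>m. m \<ge> 3 \<Longrightarrow> \<bar>cumulant m M (standardized M X)\<bar> \<le> fact m / \<Delta> ^ (m - 2)"
    and x: "x \<ge> 0"
  shows "measure M {\<omega> \<in> space M. standardized M X \<omega> \<ge> x} \<le> exp (- (1/2) * (x\<^sup>2 / (2 + x / \<Delta>)))"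
proof -
  from sf obtain B where "prob_space M" and X: "X \<in> measurable M (count_space UNIV)"
    and B: "AE \<omega> in M. X \<omega> \<le> B"
    and var: "prob_space.variance M (\<lambda>\<omega>. real (X \<omega>)) > 0"
    unfolding sector_free_rv_def by blast
  interpret prob_space M by fact
  note int = integral_bounded_nat[OF \<open>prob_space M\<close> X B]
  define \<mu> where "\<mu> = expectation (\<lambda>\<omega>. real (X \<omega>))"
  define \<sigma> where "\<sigma> = std_dev M X"
  define y where "y k = (real k - \<mu>) / \<sigma>" for k
  define p where "p k = prob (X -` {k} \<inter> space M)" for k
  have \<sigma>: "\<sigma> > 0" "\<sigma>\<^sup>2 = variance (\<lambda>\<omega>. real (X \<omega>))"
    using var by (simp_all add: \<sigma>_def std_dev_def)
  have Y: "standardized M X = (\<lambda>\<omega>. y (X \<omega>))"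
    by (simp add: standardized_def y_def \<mu>_def \<sigma>_def fun_eq_iff)
  have sum_p: "(\<Sum>k\<le>B. p k * g k) = expectation (\<lambda>\<omega>. g (X \<omega>))" for g
    by (simp add: p_def int(2))
  define \<phi> where "\<phi> = (\<lambda>t. expectation (\<lambda>\<omega>. exp (t * y (X \<omega>))))"
  have \<phi>: "\<phi> = (\<lambda>t. \<Sum>k\<le>B. p k * exp (t * y k))"
    by (simp add: \<phi>_def sum_p)
  have mgf: "\<phi> t \<le> exp (t\<^sup>2 / (1 - t / \<Delta>))" if "0 \<le> t" "t < \<Delta>" for t
  proof (rule mgf_le_of_cumulant_bounds[OF \<phi> _ _ _ _ _ \<Delta> _ that])
    show "(\<Sum>k\<le>B. p k) = 1" using sum_p[of "\<lambda>_. 1"] prob_space by simp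
    show "(\<Sum>k\<le>B. p k * y k) = 0"
      unfolding sum_p using int(1)[of real] prob_space
      by (simp add: y_def \<mu>_def)
    show "(\<Sum>k\<le>B. p k * (y k)\<^sup>2) = 1"
      unfolding sum_p using \<sigma> by (simp add: y_def power_divide \<mu>_def flip: \<sigma>(2))
    show "\<bar>(deriv ^^ m) (\<lambda>t. ln (\<phi> t)) 0\<bar> \<le> fact m / \<Delta> ^ (m - 2)" if "m \<ge> 3" for m
      using bound[OF that] by (simp add: cumulant_def Y \<phi>_def)
  qed (auto simp: p_def)
  show ?thesis
  proof (cases "x = 0")
    \<comment> \<open>Here the right-hand side is 1, while the Chernoff inequality below needs a
      positive \<open>t\<close>.\<close>
    case True
    then show ?thesis by simp
  next
    case False
    define q where "q = 2 + x / \<Delta>"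
    \<comment> \<open>This choice gives \<open>1 - t / \<Delta> = 2 / q\<close>, hence
      \<open>t < \<Delta>\<close>, and the exponent becomes - x^2/q + x^2/(2q) = - x^2/(2q).\<close>
    define t where "t = x / q"
    have q: "q > 0" using x \<Delta> by (simp add: q_def add_pos_nonneg)
    have t: "t > 0" using x False q by (simp add: t_def)
    have "1 - t / \<Delta> = (q - x / \<Delta>) / q"
      using q by (simp add: t_def diff_divide_distrib)
    then have frac: "1 - t / \<Delta> = 2 / q" by (simp add: q_def)
    then have "t / \<Delta> < 1" using q by (smt (verit) divide_pos_pos)
    then have t\<Delta>: "t < \<Delta>" using \<Delta> by simp
    have "prob {\<omega> \<in> space M. standardized M X \<omega> \<ge> x} \<le> exp (- t * x) * \<phi> t"
      using Chernoff_ineq_ge[OF t, of "space M" "\<lambda>\<omega>. y (X \<omega>)" x] int(1)[of "\<lambda>k. exp (t * y k)"]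
      by (simp add: Y \<phi>_def set_integral_space set_integrable_def
          integrable_mult_indicator[where 'b = real, simplified])
    also have "\<dots> \<le> exp (- t * x) * exp (t\<^sup>2 / (1 - t / \<Delta>))"
      using mgf t t\<Delta> by (intro mult_left_mono) auto
    also have "\<dots> = exp (- t * x + t\<^sup>2 / (1 - t / \<Delta>))" by (simp only: exp_add)
    also have "- t * x + t\<^sup>2 / (1 - t / \<Delta>) = - (1/2) * (x\<^sup>2 / q)"
      unfolding frac unfolding t_def using q by (simp add: field_simps power2_eq_square)
    finally show ?thesis by (simp add: q_def)
  qed
qed

section \<open>Transfer to the law on the natural numbers\<close>

lemma std_dev_distr:
  assumes [measurable]: "X \<in> measurable M (count_space UNIV)"
  shows "std_dev (distr M (count_space UNIV) X) id = std_dev M X"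
  by (simp add: std_dev_def integral_distr)

lemma standardized_distr:
  assumes [measurable]: "X \<in> measurable M (count_space UNIV)"
  shows "standardized (distr M (count_space UNIV) X) id (X \<omega>) = standardized M X \<omega>"
  by (simp add: standardized_def std_dev_distr integral_distr)

text \<open>The generating function, the variance and almost sure boundedness depend only on the
  law, so they survive the push-forward.\<close>

lemma sector_free_rv_distr:
  assumes "sector_free_rv M X \<delta>"
  shows "sector_free_rv (distr M (count_space UNIV) X) id \<delta>"
proof -
  from assms have X[measurable]: "X \<in> measurable M (count_space UNIV)"
    by (simp add: sector_free_rv_def)
  have "pgf (distr M (count_space UNIV) X) id = pgf M X"
    by (simp add: pgf_def integral_distr fun_eq_iff)
  then show ?thesis
    using assms unfolding sector_free_rv_def
    by (auto simp: integral_distr AE_distr_iff prob_space.prob_space_distr)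
qed

lemma measure_standardized_distr:
  assumes X: "X \<in> measurable M (count_space UNIV)"
  defines "D \<equiv> distr M (count_space UNIV) X"
  shows "measure D {k \<in> space D. standardized D id k \<ge> x}
       = measure M {\<omega> \<in> space M. standardized M X \<omega> \<ge> x}"
proof -
  have "measure D {k \<in> space D. standardized D id k \<ge> x}
      = measure M (X -` {k. standardized D id k \<ge> x} \<inter> space M)"
    unfolding D_def by (subst measure_distr[OF X]) auto
  also have "X -` {k. standardized D id k \<ge> x} \<inter> space M = {\<omega> \<in> space M. standardized M X \<omega> \<ge> x}"
    using standardized_distr[OF X] by (auto simp: D_def)
  finally show ?thesis .
qed

(* The absolute constant C must not depend on the type of the sample spaces. HOL cannot quantify
   over types below the existential quantifier; instead, a constant exists for sample spaces of
   type nat (which realise every law on the natural numbers), and every such constant works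
   unchanged for sample spaces of an arbitrary type 'a. *)
theorem corollary2p5:
  fixes c :: real
  assumes "cumulant_bound_const c"
  shows "(\<exists>C>0. tail_bound_const c TYPE(nat) C) \<and>
         (\<forall>C>0. tail_bound_const c TYPE(nat) C \<longrightarrow> tail_bound_const c TYPE('a) C)"
proof (intro conjI allI impI)
  have "tail_bound_const c TYPE(nat) 1"
    unfolding tail_bound_const_def Let_def
  proof (intro allI impI)
    fix M :: "nat \<Rightarrow> nat measure" and X \<delta> and N :: nat and x :: real
    assume sf: "\<forall>N\<ge>1. sector_free_rv (M N) (X N) (\<delta> N)" and N: "N \<ge> 1" and x: "x \<ge> 0"
    from sf N have sfN: "sector_free_rv (M N) (X N) (\<delta> N)" by blast
    then have "c * \<delta> N * std_dev (M N) (X N) > 0"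
      using assms by (simp add: cumulant_bound_const_def sector_free_rv_def std_dev_def)
    from standardized_tail_bound[OF sfN this _ x] assms sfN
    show "measure (M N) {\<omega> \<in> space (M N). standardized (M N) (X N) \<omega> \<ge> x}
      \<le> 1 * exp (- (1/2) * (x\<^sup>2 / (2 + x / (c * \<delta> N * std_dev (M N) (X N)))))"
      by (simp add: cumulant_bound_const_def)
  qed
  then show "\<exists>C>0. tail_bound_const c TYPE(nat) C" by (intro exI[of _ 1]) simp
next
  fix C :: real
  assume C: "tail_bound_const c TYPE(nat) C"
  show "tail_bound_const c TYPE('a) C"
    unfolding tail_bound_const_def Let_def
  proof (intro allI impI)
    fix M :: "nat \<Rightarrow> 'a measure" and X \<delta> and N :: nat and x :: real
    assume sf: "\<forall>N\<ge>1. sector_free_rv (M N) (X N) (\<delta> N)" and N: "N \<ge> 1" and x: "x \<ge> 0"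
    \<comment> \<open>Each \<open>X N\<close> is replaced by the identity on its law, an instance
      over \<open>nat\<close> with the same standard deviation and tail probabilities, so the same
      \<open>C\<close> applies.\<close>
    define D where "D N = distr (M N) (count_space UNIV) (X N)" for N
    from sf N have X: "X N \<in> measurable (M N) (count_space UNIV)"
      by (simp add: sector_free_rv_def)
    have "\<forall>N\<ge>1. sector_free_rv (D N) id (\<delta> N)"
      using sf sector_free_rv_distr by (auto simp: D_def)
    from C[unfolded tail_bound_const_def Let_def, rule_format, of D "\<lambda>_. id" \<delta>, OF _ N x] this
    have "measure (D N) {k \<in> space (D N). standardized (D N) id k \<ge> x}
      \<le> C * exp (- (1/2) * (x\<^sup>2 / (2 + x / (c * \<delta> N * std_dev (D N) id))))"
      by blast
    then show "measure (M N) {\<omega> \<in> space (M N). standardized (M N) (X N) \<omega> \<ge> x}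
      \<le> C * exp (- (1/2) * (x\<^sup>2 / (2 + x / (c * \<delta> N * std_dev (M N) (X N)))))"
      unfolding D_def measure_standardized_distr[OF X] std_dev_distr[OF X] .
  qed
qed

end
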